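(* Let $G$ be a global antipode graph, and for each integer $N\ge 1$ let $M_N$ be the spherical maximal operator on the Cartesian power $G^N$. Then for every $1\le p<\infty$ and every $N\ge 1$, $$\|M_N\|_p^p \;\ge\; \left(\frac{|G|}{|\mathrm{Ant}(G)|}\right)^N .$$
   Context: All graphs are simple, connected, undirected, unweighted and finite (with nonempty vertex set). For a graph $G$, $V(G)$ is the vertex set, $|G|=|V(G)|$, and $d_G$ is the shortest-path distance. The Cartesian product $G\,\square\,H$ has vertex set $V(G)\times V(H)$, with $(g,h)$ adjacent to $(g',h')$ iff either $g=g'$ and $h$ is adjacent to $h'$ in $H$, or $h=h'$ and $g$ is adjacent to $g'$ in $G$. The Cartesian power is $G^1=G$, $G^N=G^{N-1}\,\square\,G$ for $N>1$; thus $V(G^N)=V(G)^N$, and $x,y$ are adjacent iff they differ in exactly one coordinate $k$ and $x_k,y_k$ are adjacent in $G$. For $x\in V(G)$ and an integer $r\ge 0$, the sphere is $\mathbb{S}^G_r(x)=\{y\in V(G): d_G(x,y)=r\}$. The spherical maximal operator $M^G$ is defined for $f:V(G)\to\mathbb{C}$ by $$M^Gf(x)=\sup_{r\ge 0,\ \mathbb{S}^G_r(x)\ne\emptyset}\frac{1}{|\mathbb{S}^G_r(x)|}\left|\sum_{y\in \mathbb{S}^G_r(x)}f(y)\right|.$$ $L^p$ norms on $V(G)$ are with respect to counting measure, and $\|M^G\|_p=\sup_{\|f\|_p=1}\|M^Gf\|_p$. Here $M_N=M^{G^N}$. The antipode $\mathrm{Ant}_G(x)$ of a vertex $x$ is the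 nonempty sphere centered at $x$ of maximal radius with respect to $d_G$. The global antipode of $G$ is $\mathrm{Ant}(G)=\bigcup_{x\in V(G)}\mathrm{Ant}_G(x)$. $G$ is a global antipode graph (GAG) if $\mathrm{Ant}(G)\subsetneq V(G)$. *)

theory Defs
  imports Complex_Main "Graph_Theory.Graph_Theory"
begin

text \<open>
  A finite simple graph is a \<^locale>\<open>pair_graph\<close> (finite, symmetric, loop-free, no parallel arcs):
  an undirected edge is a pair of opposite arcs. \<^const>\<open>Digraph_Component.connected\<close> includes
  nonemptiness of the vertex set.
\<close>

subsection \<open>Distance, spheres and antipodes\<close>

text \<open>Only meaningful between vertices joined by a walk, hence on connected graphs.\<close>

definition graph_dist :: "'a pair_pre_digraph \<Rightarrow> 'a \<Rightarrow> 'a \<Rightarrow> nat" where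
  "graph_dist G x y = (LEAST n. \<exists>p. pre_digraph.awalk (with_proj G) x p y \<and> length p = n)"

definition graph_sphere :: "'a pair_pre_digraph \<Rightarrow> nat \<Rightarrow> 'a \<Rightarrow> 'a set" where
  "graph_sphere G r x = {y \<in> pverts G. graph_dist G x y = r}"

definition antipode :: "'a pair_pre_digraph \<Rightarrow> 'a \<Rightarrow> 'a set" where
  "antipode G x = graph_sphere G (Max {r. graph_sphere G r x \<noteq> {}}) x"

definition global_antipode :: "'a pair_pre_digraph \<Rightarrow> 'a set" where
  "global_antipode G = (\<Union>x\<in>pverts G. antipode G x)"

definition global_antipode_graph :: "'a pair_pre_digraph \<Rightarrow> bool" where
  "global_antipode_graph G \<longleftrightarrow> global_antipode G \<subset> pverts G"

text \<open>The distance is the library's shortest-path cost for unit weights.\<close>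

lemma graph_dist_eq_mu:
  assumes "pair_wf_digraph G" and "x \<rightarrow>\<^sup>*\<^bsub>with_proj G\<^esub> y"
  shows "ereal (real (graph_dist G x y)) = wf_digraph.\<mu> (with_proj G) (\<lambda>_. 1) x y"
proof -
  interpret pair_wf_digraph G by fact
  have cost: "awalk_cost (\<lambda>_. 1) p = real (length p)" for p :: "('a \<times> 'a) list"
    by (induction p) auto
  obtain q where q: "awalk x q y"
    using assms(2) reachable_awalk by blast
  have "\<exists>p. awalk x p y \<and> length p = graph_dist G x y"
    unfolding graph_dist_def by (rule LeastI_ex) (use q in blast)
  then obtain p where p: "awalk x p y" "length p = graph_dist G x y" by blast
  have least: "graph_dist G x y \<le> length p'" if "awalk x p' y" for p'
    unfolding graph_dist_def by (rule Least_le) (use that in blast)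
  have "(INF p\<in>{p. awalk x p y}. ereal (awalk_cost (\<lambda>_. 1) p)) = ereal (real (graph_dist G x y))"
  proof (rule antisym)
    show "(INF p\<in>{p. awalk x p y}. ereal (awalk_cost (\<lambda>_. 1) p)) \<le> ereal (real (graph_dist G x y))"
      by (rule INF_lower2[of p]) (use p cost in auto)
    show "ereal (real (graph_dist G x y)) \<le> (INF p\<in>{p. awalk x p y}. ereal (awalk_cost (\<lambda>_. 1) p))"
      by (rule INF_greatest) (use least cost in auto)
  qed
  then show ?thesis by (simp add: \<mu>_def)
qed

subsection \<open>Cartesian products and powers\<close>

definition cart_prod :: "'a pair_pre_digraph \<Rightarrow> 'b pair_pre_digraph \<Rightarrow> ('a \<times> 'b) pair_pre_digraph" where
  "cart_prod G H =
    \<lparr> pverts = pverts G \<times> pverts H,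
      parcs = {((g, h), (g', h')) | g h g' h'.
        (g = g' \<and> g \<in> pverts G \<and> (h, h') \<in> parcs H) \<or>
        (h = h' \<and> h \<in> pverts H \<and> (g, g') \<in> parcs G)} \<rparr>"

text \<open>
  Vertices of the \<open>N\<close>-th power are the lists of length \<open>N\<close> over the vertices of \<open>G\<close>, so that all
  powers live in one type. The two lemmas below recover the recursive definition through
  \<^const>\<open>cart_prod\<close>, up to this encoding of tuples.
\<close>

definition cart_power :: "'a pair_pre_digraph \<Rightarrow> nat \<Rightarrow> 'a list pair_pre_digraph" where
  "cart_power G N =
    \<lparr> pverts = {xs. length xs = N \<and> set xs \<subseteq> pverts G},
      parcs = {(xs, ys). length xs = N \<and> set xs \<subseteq> pverts G \<and> length ys = N \<and> set ys \<subseteq> pverts G \<and>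
        (\<exists>k<N. (xs ! k, ys ! k) \<in> parcs G \<and> (\<forall>j<N. j \<noteq> k \<longrightarrow> xs ! j = ys ! j))} \<rparr>"

definition relabel :: "('a \<Rightarrow> 'b) \<Rightarrow> 'a pair_pre_digraph \<Rightarrow> 'b pair_pre_digraph" where
  "relabel h G = \<lparr> pverts = h ` pverts G, parcs = map_prod h h ` parcs G \<rparr>"

lemma cart_power_1:
  assumes "pair_wf_digraph G"
  shows "cart_power G 1 = relabel (\<lambda>x. [x]) G"
proof -
  interpret pair_wf_digraph G by fact
  have "{(xs, ys). length xs = 1 \<and> set xs \<subseteq> pverts G \<and> length ys = 1 \<and> set ys \<subseteq> pverts G \<and>
        (\<exists>k<1. (xs ! k, ys ! k) \<in> parcs G \<and> (\<forall>j<1. j \<noteq> k \<longrightarrow> xs ! j = ys ! j))}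
      = map_prod (\<lambda>x. [x]) (\<lambda>x. [x]) ` parcs G"
    by (force simp: length_Suc_conv image_iff dest: in_arcsD1 in_arcsD2)
  moreover have "{xs. length xs = 1 \<and> set xs \<subseteq> pverts G} = (\<lambda>x. [x]) ` pverts G"
    by (auto simp: length_Suc_conv)
  ultimately show ?thesis
    unfolding cart_power_def relabel_def by simp
qed

lemma cart_power_Suc:
  assumes "pair_wf_digraph G"
  shows "cart_power G (Suc N) = relabel (\<lambda>(xs, x). xs @ [x]) (cart_prod (cart_power G N) G)"
proof -
  interpret pair_wf_digraph G by fact
  let ?h = "\<lambda>(xs, x). xs @ [x]"
  have snoc: "(length zs = Suc N \<and> set zs \<subseteq> pverts G) \<longleftrightarrow>
      (\<exists>xs x. zs = xs @ [x] \<and> length xs = N \<and> set xs \<subseteq> pverts G \<and> x \<in> pverts G)" for zs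
    by (cases zs rule: rev_cases) auto
  have verts: "pverts (cart_power G (Suc N)) = ?h ` pverts (cart_prod (cart_power G N) G)"
    unfolding cart_power_def cart_prod_def using snoc by (auto simp: image_iff)
  have arc: "(xs @ [x], ys @ [y]) \<in> parcs (cart_power G (Suc N)) \<longleftrightarrow>
      ((xs, x), (ys, y)) \<in> parcs (cart_prod (cart_power G N) G)"
    (is "?L \<longleftrightarrow> ?R") for xs ys x y
  proof
    assume ?L
    then have len: "length xs = N" "length ys = N"
      and sub: "set xs \<subseteq> pverts G" "set ys \<subseteq> pverts G" "x \<in> pverts G" "y \<in> pverts G"
      and "\<exists>k<Suc N. ((xs @ [x]) ! k, (ys @ [y]) ! k) \<in> parcs G \<and>
        (\<forall>j<Suc N. j \<noteq> k \<longrightarrow> (xs @ [x]) ! j = (ys @ [y]) ! j)"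
      by (auto simp: cart_power_def)
    then obtain k where k: "k < Suc N" "((xs @ [x]) ! k, (ys @ [y]) ! k) \<in> parcs G"
      and eq: "\<And>j. j < Suc N \<Longrightarrow> j \<noteq> k \<Longrightarrow> (xs @ [x]) ! j = (ys @ [y]) ! j" by blast
    show ?R
    proof (cases "k = N")
      case True
      have "xs = ys"
      proof (rule nth_equalityI)
        fix i assume "i < length xs"
        then show "xs ! i = ys ! i" using eq[of i] True len by (simp add: nth_append)
      qed (use len in simp)
      moreover have "(x, y) \<in> parcs G" using k(2) True len by (simp add: nth_append)
      ultimately show ?thesis using len sub by (simp add: cart_prod_def cart_power_def)
    next
      case False
      then have "k < N" using k by simp
      moreover have "x = y" using eq[of N] False len by (simp add: nth_append)
      moreover have "(xs ! k, ys ! k) \<in> parcs G" using k(2) \<open>k < N\<close> len by (simp add: nth_append)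
      moreover have "\<forall>j<N. j \<noteq> k \<longrightarrow> xs ! j = ys ! j"
      proof (intro allI impI)
        fix j assume "j < N" "j \<noteq> k"
        then show "xs ! j = ys ! j" using eq[of j] len by (simp add: nth_append)
      qed
      ultimately show ?thesis using len sub by (auto simp: cart_prod_def cart_power_def)
    qed
  next
    assume ?R
    then consider "xs = ys" "xs \<in> pverts (cart_power G N)" "(x, y) \<in> parcs G"
      | "x = y" "x \<in> pverts G" "(xs, ys) \<in> parcs (cart_power G N)"
      by (auto simp: cart_prod_def)
    then show ?L
    proof cases
      case 1
      then show ?thesis
        by (auto simp: cart_power_def nth_append dest: in_arcsD1 in_arcsD2 intro!: exI[of _ N])
    next
      case 2
      then obtain k where "k < N" "(xs ! k, ys ! k) \<in> parcs G" "\<forall>j<N. j \<noteq> k \<longrightarrow> xs ! j = ys ! j"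
        "length xs = N" "length ys = N" "set xs \<subseteq> pverts G" "set ys \<subseteq> pverts G"
        by (auto simp: cart_power_def)
      then show ?thesis using 2(1,2)
        by (auto simp: cart_power_def nth_append intro!: exI[of _ k])
    qed
  qed
  have arcs: "parcs (cart_power G (Suc N)) = map_prod ?h ?h ` parcs (cart_prod (cart_power G N) G)"
    (is "?A = ?B")
  proof (intro equalityI subrelI)
    fix as bs assume *: "(as, bs) \<in> ?A"
    then have "length as = Suc N" "length bs = Suc N" by (auto simp: cart_power_def)
    then obtain xs x ys y where e: "as = xs @ [x]" "bs = ys @ [y]"
      by (metis length_Suc_conv_rev)
    then have "((xs, x), (ys, y)) \<in> parcs (cart_prod (cart_power G N) G)" using * arc by simp
    then show "(as, bs) \<in> ?B" using e by (force simp: image_iff)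
  next
    fix as bs assume "(as, bs) \<in> ?B"
    then obtain xs x ys y where "as = xs @ [x]" "bs = ys @ [y]"
      "((xs, x), (ys, y)) \<in> parcs (cart_prod (cart_power G N) G)" by auto
    then show "(as, bs) \<in> ?A" using arc by simp
  qed
  show ?thesis
    using verts arcs by (simp add: relabel_def)
qed

subsection \<open>Spherical maximal operator and norms\<close>

text \<open>
  Functions on the vertex set are total functions of which only the values on the vertices matter.
  On a finite nonempty vertex set both real suprema below are over nonempty bounded sets; for the
  operator norm this is \<open>bdd_above_spherical_max\<close>.
\<close>

definition spherical_max :: "'a pair_pre_digraph \<Rightarrow> ('a \<Rightarrow> complex) \<Rightarrow> 'a \<Rightarrow> real" where
  "spherical_max G f x =
    Sup {1 / real (card (graph_sphere G r x)) * cmod (\<Sum>y\<in>graph_sphere G r x. f y) | r.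
      graph_sphere G r x \<noteq> {}}"

definition lp_norm :: "'a pair_pre_digraph \<Rightarrow> real \<Rightarrow> ('a \<Rightarrow> 'b::real_normed_vector) \<Rightarrow> real" where
  "lp_norm G p f = (\<Sum>x\<in>pverts G. norm (f x) powr p) powr (1 / p)"

definition lp_op_norm :: "'a pair_pre_digraph \<Rightarrow> real \<Rightarrow>
    (('a \<Rightarrow> complex) \<Rightarrow> 'a \<Rightarrow> real) \<Rightarrow> real" where
  "lp_op_norm G p T = Sup {lp_norm G p (T f) | f. lp_norm G p f = 1}"

lemma bdd_above_spherical_max:
  assumes fin: "finite (pverts G)" and p: "1 \<le> p"
  shows "bdd_above {lp_norm G p (spherical_max G f) | f. lp_norm G p f = 1}"
proof (rule bdd_aboveI)
  fix c assume "c \<in> {lp_norm G p (spherical_max G f) | f. lp_norm G p f = 1}"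
  then obtain f where c: "c = lp_norm G p (spherical_max G f)" and f: "lp_norm G p f = 1" by blast
  have "(\<Sum>x\<in>pverts G. norm (f x) powr p) = 1"
  proof -
    have "(\<Sum>x\<in>pverts G. norm (f x) powr p) = lp_norm G p f powr p"
      using p by (simp add: lp_norm_def powr_powr sum_nonneg)
    then show ?thesis using f by simp
  qed
  then have pw: "norm (f x) powr p \<le> 1" if "x \<in> pverts G" for x
    using member_le_sum[of x "pverts G" "\<lambda>x. norm (f x) powr p"] that fin by simp
  have f1: "norm (f x) \<le> 1" if "x \<in> pverts G" for x
  proof (rule ccontr)
    assume "\<not> norm (f x) \<le> 1"
    then have "1 < norm (f x) powr p" using p by (intro gr_one_powr) auto
    then show False using pw[OF that] by simp
  qed
  have avg: "0 \<le> a \<and> a \<le> 1"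
    if "a \<in> {1 / real (card (graph_sphere G r x)) * cmod (\<Sum>y\<in>graph_sphere G r x. f y) | r.
      graph_sphere G r x \<noteq> {}}" for a x
  proof -
    from that obtain r where
      a: "a = 1 / real (card (graph_sphere G r x)) * cmod (\<Sum>y\<in>graph_sphere G r x. f y)"
      and ne: "graph_sphere G r x \<noteq> {}" by blast
    have fs: "finite (graph_sphere G r x)" using fin by (simp add: graph_sphere_def)
    have "cmod (\<Sum>y\<in>graph_sphere G r x. f y) \<le> (\<Sum>y\<in>graph_sphere G r x. 1)"
      by (rule sum_norm_le) (use f1 in \<open>auto simp: graph_sphere_def\<close>)
    then show ?thesis using ne fs by (simp add: a card_gt_0_iff divide_le_eq)
  qed
  have M: "norm (spherical_max G f x) powr p \<le> 1" if "x \<in> pverts G" for x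
  proof -
    let ?S = "{1 / real (card (graph_sphere G r x)) * cmod (\<Sum>y\<in>graph_sphere G r x. f y) | r.
      graph_sphere G r x \<noteq> {}}"
    have "x \<in> graph_sphere G (graph_dist G x x) x" using that by (simp add: graph_sphere_def)
    then obtain a where a: "a \<in> ?S" by blast
    have "Sup ?S \<le> 1" by (rule cSup_least) (use a avg in blast)+
    moreover have "0 \<le> Sup ?S"
      by (rule cSup_upper2[OF a]) (use a avg in \<open>auto intro!: bdd_aboveI[of _ 1]\<close>)
    ultimately show ?thesis unfolding spherical_max_def using p by (simp add: powr_le1)
  qed
  have "(\<Sum>x\<in>pverts G. norm (spherical_max G f x) powr p) \<le> real (card (pverts G))"
    using sum_mono[of "pverts G" "\<lambda>x. norm (spherical_max G f x) powr p" "\<lambda>_. 1"] M by simp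
  then show "c \<le> real (card (pverts G)) powr (1 / p)"
    unfolding c lp_norm_def using p by (intro powr_mono2) (auto intro: sum_nonneg)
qed

end

theory Submission
  imports Defs
begin

text \<open>
  Distances in \<open>G\<^sup>N\<close> add up over the coordinates, so the sphere of maximal radius about a point is
  the product of the coordinatewise antipodes and lies in \<open>Ant(G)\<^sup>N\<close>. The maximal function of the
  indicator of \<open>Ant(G)\<^sup>N\<close> is therefore at least 1 everywhere, so its \<open>p\<close>-th power norm is at least
  \<open>|G|\<^sup>N\<close>, against \<open>|Ant(G)|\<^sup>N\<close> for the indicator.
\<close>

subsection \<open>Distances through relation powers\<close>

text \<open>Turns walks into powers of the arc relation, so that concatenating and splitting walks
  becomes \<open>relpow\<close> algebra. The empty walk needs \<open>x\<close> to be a vertex, while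
  \<open>^^ 0\<close> is the identity on the whole type.\<close>

lemma awalk_iff_relpow:
  assumes "pair_wf_digraph G" and "x \<in> pverts G"
  shows "(\<exists>p. pre_digraph.awalk (with_proj G) x p y \<and> length p = n) \<longleftrightarrow> (x, y) \<in> parcs G ^^ n"
proof -
  interpret pair_wf_digraph G by fact
  show ?thesis
    using assms(2)
  proof (induction n arbitrary: x)
    case 0
    then show ?case by (auto simp: awalk_Nil_iff)
  next
    case (Suc n)
    have "(\<exists>p. awalk x p y \<and> length p = Suc n) \<longleftrightarrow>
        (\<exists>z. (x, z) \<in> parcs G \<and> (\<exists>p. awalk z p y \<and> length p = n))"
      (is "?L \<longleftrightarrow> ?R")
    proof
      assume ?L
      then obtain e p where "awalk x (e # p) y" "length p = n"
        by (metis length_Suc_conv)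
      then show ?R by (cases e) (auto simp: awalk_Cons_iff)
    next
      assume ?R
      then obtain z p where z: "(x, z) \<in> parcs G" and p: "awalk z p y" "length p = n" by blast
      then have "awalk x ((x, z) # p) y" by (simp add: awalk_Cons_iff)
      then show ?L using p(2) by (intro exI[of _ "(x, z) # p"]) simp
    qed
    also have "\<dots> \<longleftrightarrow> (\<exists>z. (x, z) \<in> parcs G \<and> (z, y) \<in> parcs G ^^ n)"
      using Suc.IH in_arcsD2 by blast
    \<comment> \<open>Arc lists are peeled at the front, whereas \<open>^^\<close> unfolds at the
      last step; hence the \<open>_D2\<close> and \<open>_I2\<close> rules.\<close>
    also have "\<dots> \<longleftrightarrow> (x, y) \<in> parcs G ^^ Suc n"
      by (meson relpow_Suc_D2 relpow_Suc_I2)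
    finally show ?case .
  qed
qed

lemma graph_dist_relpow:
  assumes "pair_wf_digraph G" and "x \<in> pverts G"
  shows "graph_dist G x y = (LEAST n. (x, y) \<in> parcs G ^^ n)"
  unfolding graph_dist_def using awalk_iff_relpow[OF assms] by simp

lemma graph_dist_le:
  assumes "pair_wf_digraph G" and "x \<in> pverts G" and "(x, y) \<in> parcs G ^^ n"
  shows "graph_dist G x y \<le> n"
  unfolding graph_dist_relpow[OF assms(1,2)] using assms(3) by (rule Least_le)

text \<open>Symmetry of the arcs upgrades connectedness to strong connectedness, so some walk exists
  and the \<open>LEAST\<close> is attained.\<close>

lemma connected_relpow_graph_dist:
  assumes "pair_graph G" and "Digraph_Component.connected (with_proj G)"
    and "x \<in> pverts G" and "y \<in> pverts G"
  shows "(x, y) \<in> parcs G ^^ graph_dist G x y"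
proof -
  interpret pair_graph G by fact
  have "x \<rightarrow>\<^sup>*\<^bsub>with_proj G\<^esub> y"
    using symmetric_connected_imp_strongly_connected[OF sym_arcs assms(2)] assms(3,4)
    by (auto simp: strongly_connected_def)
  then obtain p where "awalk x p y"
    using reachable_awalk by blast
  then have "(x, y) \<in> parcs G ^^ length p"
    using awalk_iff_relpow[OF pair_wf_digraph_axioms assms(3)] by blast
  then show ?thesis
    unfolding graph_dist_relpow[OF pair_wf_digraph_axioms assms(3)] by (rule LeastI)
qed

subsection \<open>Distances in Cartesian powers\<close>

lemma cart_power_verts:
  "xs \<in> pverts (cart_power G N) \<longleftrightarrow> length xs = N \<and> set xs \<subseteq> pverts G"
  by (simp add: cart_power_def)

lemma pair_wf_digraph_cart_power: "pair_wf_digraph (cart_power G N)"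
  by unfold_locales (auto simp: cart_power_def)

lemma finite_cart_power_verts:
  "finite (pverts G) \<Longrightarrow> finite (pverts (cart_power G N))"
  using finite_lists_length_eq[of "pverts G" N] by (simp add: cart_power_def conj_commute)

text \<open>Lifts a walk in one factor, with all other coordinates frozen. Writing both ends as
  updates of one list keeps the induction inside coordinate \<open>k\<close>.\<close>

lemma cart_power_relpow_update:
  assumes "pair_wf_digraph G" and "(u, v) \<in> parcs G ^^ n"
    and "length zs = N" and "set zs \<subseteq> pverts G" and "k < N" and "u \<in> pverts G"
  shows "(zs[k := u], zs[k := v]) \<in> parcs (cart_power G N) ^^ n"
  using assms(2)
proof (induction n arbitrary: v)
  case (Suc n)
  interpret pair_wf_digraph G by fact
  obtain w where w: "(u, w) \<in> parcs G ^^ n" "(w, v) \<in> parcs G"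
    using Suc.prems by auto
  have "w \<in> pverts G" "v \<in> pverts G"
    using w(2) in_arcsD1 in_arcsD2 by auto
  then have "(zs[k := w], zs[k := v]) \<in> parcs (cart_power G N)"
    using assms w(2) set_update_subset_insert[of zs k]
    by (auto simp: cart_power_def intro!: exI[of _ k])
  then show ?case using Suc.IH[OF w(1)] by auto
qed simp

text \<open>Replace the coordinates one at a time from left to right and concatenate the lifted
  walks.\<close>

lemma cart_power_relpow_sum:
  assumes "pair_wf_digraph G"
    and "xs \<in> pverts (cart_power G N)" and "ys \<in> pverts (cart_power G N)"
    and "\<And>i. i < N \<Longrightarrow> (xs ! i, ys ! i) \<in> parcs G ^^ m i"
  shows "(xs, ys) \<in> parcs (cart_power G N) ^^ sum m {..<N}"
proof -
  have len: "length xs = N" "length ys = N" and sub: "set xs \<subseteq> pverts G" "set ys \<subseteq> pverts G"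
    using assms(2,3) by (simp_all add: cart_power_verts)
  have "(xs, take k ys @ drop k xs) \<in> parcs (cart_power G N) ^^ sum m {..<k}" if "k \<le> N" for k
    using that
  proof (induction k)
    case (Suc k)
    let ?zs = "take k ys @ drop k xs"
    have k: "k < N" using Suc.prems by simp
    have "set ?zs \<subseteq> pverts G"
      using sub set_take_subset[of k ys] set_drop_subset[of k xs] by auto
    moreover have "xs ! k \<in> pverts G" using k len sub by (simp add: subset_iff)
    ultimately have "(?zs[k := xs ! k], ?zs[k := ys ! k]) \<in> parcs (cart_power G N) ^^ m k"
      using cart_power_relpow_update[OF assms(1) assms(4)[OF k], of ?zs N k] k len by simp
    \<comment> \<open>Entry \<open>k\<close> has not been replaced yet, so the lifted walk starts
      where the previous ones end.\<close>
    moreover have "?zs[k := xs ! k] = ?zs"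
      using k len by (simp add: list_update_append Cons_nth_drop_Suc[symmetric])
    moreover have "?zs[k := ys ! k] = take (Suc k) ys @ drop (Suc k) xs"
      using k len
      by (simp add: list_update_append Cons_nth_drop_Suc[symmetric] take_Suc_conv_app_nth)
    ultimately have "(xs, take (Suc k) ys @ drop (Suc k) xs)
        \<in> parcs (cart_power G N) ^^ sum m {..<k} O parcs (cart_power G N) ^^ m k"
      using Suc by auto
    then show ?case by (simp add: relpow_add)
  qed simp
  from this[of N] show ?thesis using len by simp
qed

text \<open>Each arc of the power moves exactly one coordinate; \<open>m i\<close> counts the arcs
  that move coordinate \<open>i\<close>.\<close>

lemma relpow_cart_power_split:
  assumes "(xs, ys) \<in> parcs (cart_power G N) ^^ n"
  shows "\<exists>m. (\<forall>i<N. (xs ! i, ys ! i) \<in> parcs G ^^ m i) \<and> sum m {..<N} = n"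
  using assms
proof (induction n arbitrary: ys)
  case 0
  then show ?case by (intro exI[of _ "\<lambda>_. 0"]) simp
next
  case (Suc n)
  then obtain zs where zs: "(xs, zs) \<in> parcs (cart_power G N) ^^ n"
    and step: "(zs, ys) \<in> parcs (cart_power G N)" by auto
  obtain m where m: "\<forall>i<N. (xs ! i, zs ! i) \<in> parcs G ^^ m i" "sum m {..<N} = n"
    using Suc.IH[OF zs] by blast
  obtain k where k: "k < N" "(zs ! k, ys ! k) \<in> parcs G"
    and eq: "\<forall>j<N. j \<noteq> k \<longrightarrow> zs ! j = ys ! j"
    using step by (auto simp: cart_power_def)
  let ?m = "m(k := Suc (m k))"
  have "\<forall>i<N. (xs ! i, ys ! i) \<in> parcs G ^^ ?m i"
    using m(1) k eq by auto
  moreover have "sum ?m {..<N} = Suc n"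
    using k(1) m(2) by (simp add: sum.remove[of "{..<N}" k])
  ultimately show ?case by blast
qed

text \<open>Concatenated coordinate geodesics bound the distance from above; splitting an arbitrary
  walk into its coordinates bounds it from below.\<close>

lemma graph_dist_cart_power:
  assumes "pair_graph G" and "Digraph_Component.connected (with_proj G)"
    and xs: "xs \<in> pverts (cart_power G N)" and ys: "ys \<in> pverts (cart_power G N)"
  shows "graph_dist (cart_power G N) xs ys = (\<Sum>i<N. graph_dist G (xs ! i) (ys ! i))"
proof -
  interpret pair_graph G by fact
  note wf = pair_wf_digraph_axioms
  have V: "xs ! i \<in> pverts G" "ys ! i \<in> pverts G" if "i < N" for i
    using xs ys that by (auto simp: cart_power_verts subset_iff)
  have path: "(xs, ys) \<in> parcs (cart_power G N) ^^ (\<Sum>i<N. graph_dist G (xs ! i) (ys ! i))"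
    using cart_power_relpow_sum[OF wf xs ys] connected_relpow_graph_dist[OF assms(1,2)] V by simp
  have "(\<Sum>i<N. graph_dist G (xs ! i) (ys ! i)) \<le> n"
    if n: "(xs, ys) \<in> parcs (cart_power G N) ^^ n" for n
  proof -
    obtain m where m: "\<forall>i<N. (xs ! i, ys ! i) \<in> parcs G ^^ m i" "sum m {..<N} = n"
      using relpow_cart_power_split[OF n] by blast
    show ?thesis
      unfolding m(2)[symmetric] by (rule sum_mono) (use m(1) graph_dist_le[OF wf] V in simp)
  qed
  then show ?thesis
    unfolding graph_dist_relpow[OF pair_wf_digraph_cart_power xs]
    using path by (intro Least_equality)
qed

subsection \<open>Antipodes\<close>

text \<open>Shows the radii as the image of a finite set, which is what \<open>Max\<close> and
  boundedness of the averages rely on.\<close>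

lemma radii_eq_image: "{r. graph_sphere G r x \<noteq> {}} = graph_dist G x ` pverts G"
  by (auto simp: graph_sphere_def)

lemma antipode_nonempty:
  assumes "finite (pverts G)" and "x \<in> pverts G"
  shows "antipode G x \<noteq> {}"
proof -
  have "Max (graph_dist G x ` pverts G) \<in> graph_dist G x ` pverts G"
    using assms by (intro Max_in) auto
  then show ?thesis
    unfolding antipode_def radii_eq_image by (auto simp: graph_sphere_def)
qed

text \<open>With \<open>in_antipodeI\<close>, lets the antipode be used as the set of farthest
  vertices, without unfolding \<open>Max\<close>.\<close>

lemma graph_dist_le_antipode:
  assumes "finite (pverts G)" and "y \<in> pverts G" and "z \<in> antipode G x"
  shows "graph_dist G x y \<le> graph_dist G x z"
proof -
  have "graph_dist G x z = Max (graph_dist G x ` pverts G)"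
    using assms(3) unfolding antipode_def radii_eq_image by (simp add: graph_sphere_def)
  then show ?thesis using assms(1,2) by simp
qed

lemma in_antipodeI:
  assumes "y \<in> pverts G" and "z \<in> antipode G x" and "graph_dist G x y = graph_dist G x z"
  shows "y \<in> antipode G x"
  using assms by (simp add: antipode_def graph_sphere_def)

lemma antipode_subset_verts: "antipode G x \<subseteq> pverts G"
  by (auto simp: antipode_def graph_sphere_def)

text \<open>Exchange argument: putting an antipodal \<open>z\<close> into coordinate
  \<open>i\<close> of \<open>ys\<close> cannot increase the total distance and leaves the other
  summands alone, so \<open>ys ! i\<close> is already as far from \<open>xs ! i\<close> as
  \<open>z\<close> is.\<close>

lemma antipode_cart_power_nth:
  assumes "pair_graph G" and "Digraph_Component.connected (with_proj G)"
    and xs: "xs \<in> pverts (cart_power G N)" and ys: "ys \<in> antipode (cart_power G N) xs"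
    and "i < N"
  shows "ys ! i \<in> antipode G (xs ! i)"
proof -
  interpret pair_graph G by fact
  have ysV: "ys \<in> pverts (cart_power G N)"
    by (rule subsetD[OF antipode_subset_verts ys])
  have V: "xs ! j \<in> pverts G" "ys ! j \<in> pverts G" if "j < N" for j
    using xs ysV that by (auto simp: cart_power_verts subset_iff)
  obtain z where z: "z \<in> antipode G (xs ! i)"
    using antipode_nonempty[OF finite_verts] V(1)[OF assms(5)] by auto
  let ?zs = "ys[i := z]"
  have "?zs \<in> pverts (cart_power G N)"
    using ysV z antipode_subset_verts[of G "xs ! i"] set_update_subset_insert[of ys i z]
    by (auto simp: cart_power_verts)
  then have "(\<Sum>j<N. graph_dist G (xs ! j) (?zs ! j)) \<le> (\<Sum>j<N. graph_dist G (xs ! j) (ys ! j))"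
    using graph_dist_le_antipode[OF finite_cart_power_verts[OF finite_verts] _ ys] xs ysV
    by (simp add: graph_dist_cart_power[OF assms(1,2)])
  moreover have "(\<Sum>j\<in>{..<N} - {i}. graph_dist G (xs ! j) (?zs ! j)) =
      (\<Sum>j\<in>{..<N} - {i}. graph_dist G (xs ! j) (ys ! j))"
    by (rule sum.cong) auto
  moreover have "length ys = N" using ysV by (simp add: cart_power_verts)
  ultimately have "graph_dist G (xs ! i) z \<le> graph_dist G (xs ! i) (ys ! i)"
    using assms(5) by (simp add: sum.remove[of "{..<N}" i])
  then have "graph_dist G (xs ! i) (ys ! i) = graph_dist G (xs ! i) z"
    using graph_dist_le_antipode[OF finite_verts V(2)[OF assms(5)] z] by (rule antisym[rotated])
  then show ?thesis
    by (rule in_antipodeI[OF V(2)[OF assms(5)] z])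
qed

text \<open>An inclusion suffices: \<open>spherical_max_norm_ge\<close> accepts any set of vertices
  covering the global antipode, and this one has a known cardinality.\<close>

lemma global_antipode_cart_power:
  assumes "pair_graph G" and "Digraph_Component.connected (with_proj G)"
  shows "global_antipode (cart_power G N) \<subseteq> {ys. set ys \<subseteq> global_antipode G \<and> length ys = N}"
proof
  fix ys assume "ys \<in> global_antipode (cart_power G N)"
  then obtain xs where xs: "xs \<in> pverts (cart_power G N)"
    and ys: "ys \<in> antipode (cart_power G N) xs"
    unfolding global_antipode_def by blast
  have len: "length ys = N"
    using subsetD[OF antipode_subset_verts ys] by (simp add: cart_power_verts)
  have "ys ! i \<in> global_antipode G" if "i < N" for i
  proof -
    have "xs ! i \<in> pverts G" using xs that by (auto simp: cart_power_verts subset_iff)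
    then show ?thesis
      using antipode_cart_power_nth[OF assms xs ys that] unfolding global_antipode_def by blast
  qed
  then show "ys \<in> {ys. set ys \<subseteq> global_antipode G \<and> length ys = N}"
    using len by (auto simp: in_set_conv_nth)
qed

subsection \<open>The maximal operator\<close>

text \<open>The antipode is itself a sphere, so the average over it, which is \<open>a\<close>,
  competes in the supremum.\<close>

lemma spherical_max_ge_const_on_antipode:
  assumes "finite (pverts G)" and "x \<in> pverts G" and "\<And>y. y \<in> antipode G x \<Longrightarrow> f y = a"
  shows "spherical_max G f x \<ge> cmod a"
proof -
  let ?avg = "\<lambda>r. 1 / real (card (graph_sphere G r x)) * cmod (\<Sum>y\<in>graph_sphere G r x. f y)"
  let ?R = "{r. graph_sphere G r x \<noteq> {}}"
  let ?r = "Max ?R"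
  have ne: "graph_sphere G ?r x \<noteq> {}"
    using antipode_nonempty[OF assms(1,2)] by (simp add: antipode_def)
  have "finite (graph_sphere G ?r x)" using assms(1) by (simp add: graph_sphere_def)
  moreover have "(\<Sum>y\<in>graph_sphere G ?r x. f y) = of_nat (card (graph_sphere G ?r x)) * a"
    using assms(3) by (simp add: antipode_def)
  ultimately have "?avg ?r = cmod a"
    using ne by (simp add: norm_mult)
  moreover have "?avg ?r \<le> Sup (?avg ` ?R)"
  proof (rule cSup_upper)
    show "?avg ?r \<in> ?avg ` ?R" using ne by (intro imageI) simp
    show "bdd_above (?avg ` ?R)" unfolding radii_eq_image using assms(1) by simp
  qed
  moreover have "spherical_max G f x = Sup (?avg ` ?R)"
    unfolding spherical_max_def by (rule arg_cong[of _ _ Sup]) blast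
  ultimately show ?thesis by simp
qed

text \<open>The test function is the normalised indicator of \<open>S\<close>. Every antipode lies
  in \<open>S\<close>, so its maximal function is at least the height \<open>c\<close> at every
  vertex.\<close>

lemma spherical_max_norm_ge:
  assumes fin: "finite (pverts G)" and p: "1 \<le> p"
    and S: "global_antipode G \<subseteq> S" "S \<subseteq> pverts G" "S \<noteq> {}"
  shows "real (card (pverts G)) / real (card S) \<le> lp_op_norm G p (spherical_max G) powr p"
proof -
  \<comment> \<open>Solves \<open>card S * c powr p = 1\<close>, which gives the test function norm
    1.\<close>
  define c where "c = real (card S) powr (- 1 / p)"
  define f where "f x = (if x \<in> S then complex_of_real c else 0)" for x
  have S0: "0 < real (card S)"
    using S fin by (simp add: card_gt_0_iff finite_subset)
  have c0: "0 \<le> c" by (simp add: c_def)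
  have cp: "c powr p = 1 / real (card S)"
    using p S0 unfolding c_def powr_powr by (simp add: powr_minus_divide)
  \<comment> \<open>Vertices outside \<open>S\<close> contribute nothing, because
    \<open>0 powr p = 0\<close>.\<close>
  have "(\<Sum>x\<in>pverts G. norm (f x) powr p) = (\<Sum>x\<in>S. c powr p)"
    using S(2) fin p c0 by (intro sum.mono_neutral_cong_right) (auto simp: f_def)
  then have f1: "lp_norm G p f = 1"
    using cp S0 by (simp add: lp_norm_def)
  have "c powr p \<le> norm (spherical_max G f x) powr p" if x: "x \<in> pverts G" for x
  proof -
    have "f y = complex_of_real c" if "y \<in> antipode G x" for y
      using that x S(1) by (auto simp: f_def global_antipode_def)
    then have "cmod (complex_of_real c) \<le> spherical_max G f x"
      by (rule spherical_max_ge_const_on_antipode[OF fin x])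
    then have "c \<le> spherical_max G f x" using c0 by simp
    then show ?thesis using c0 p by (intro powr_mono2) auto
  qed
  then have "real (card (pverts G)) / real (card S) \<le> (\<Sum>x\<in>pverts G. norm (spherical_max G f x) powr p)"
    using sum_mono[of "pverts G" "\<lambda>_. c powr p"] cp by simp
  also have "\<dots> = lp_norm G p (spherical_max G f) powr p"
    using p by (simp add: lp_norm_def powr_powr sum_nonneg)
  \<comment> \<open>A real \<open>Sup\<close> dominates its members only if the set is bounded,
    hence \<open>bdd_above_spherical_max\<close>.\<close>
  also have "\<dots> \<le> lp_op_norm G p (spherical_max G) powr p"
    unfolding lp_op_norm_def
    using p f1 bdd_above_spherical_max[OF fin p]
    by (intro powr_mono2 cSup_upper) (auto simp: lp_norm_def)
  finally show ?thesis .
qed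

theorem theorem2p6:
  fixes G :: "'a pair_pre_digraph" and p :: real and N :: nat
  assumes "pair_graph G"
    and "Digraph_Component.connected (with_proj G)"
    and "global_antipode_graph G"
    and "1 \<le> p"
    and "1 \<le> N"
  shows "lp_op_norm (cart_power G N) p (spherical_max (cart_power G N)) powr p
    \<ge> (real (card (pverts G)) / real (card (global_antipode G))) ^ N"
proof -
  interpret pair_graph G by fact
  let ?S = "{ys. set ys \<subseteq> global_antipode G \<and> length ys = N}"
  have sub: "global_antipode G \<subseteq> pverts G"
    using assms(3) by (auto simp: global_antipode_graph_def)
  obtain x where "x \<in> pverts G"
    using assms(3) by (auto simp: global_antipode_graph_def)
  then obtain a where "a \<in> global_antipode G"
    using antipode_nonempty[OF finite_verts] by (force simp: global_antipode_def)
  \<comment> \<open>A constant tuple shows that \<open>?S\<close> is nonempty, so that its indicator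
    can be normalised.\<close>
  then have "replicate N a \<in> ?S" by auto
  then have "real (card (pverts (cart_power G N))) / real (card ?S)
      \<le> lp_op_norm (cart_power G N) p (spherical_max (cart_power G N)) powr p"
    using sub by (intro spherical_max_norm_ge finite_cart_power_verts assms(4)
        global_antipode_cart_power assms(1,2)) (auto simp: cart_power_verts)
  moreover have "card (pverts (cart_power G N)) = card (pverts G) ^ N"
    using card_lists_length_eq[OF finite_verts, of N] by (simp add: cart_power_def conj_commute)
  moreover have "card ?S = card (global_antipode G) ^ N"
    using finite_subset[OF sub finite_verts] by (rule card_lists_length_eq)
  ultimately show ?thesis by (simp add: power_divide)
qed

end
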